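(* Let $\mathbf{F}^*$ be a consistent entropy conservative numerical flux for $\mathbf{u}_t+\mathbf{f}(\mathbf{u})_x=0$ with associated numerical entropy flux $q^*$, and let $\mathbf{F}^s$ be a consistent (non-oscillatory) numerical flux for the same system. Define the numerical flux $$\hat{\mathbf{F}}_{i+\frac12}=\mathbf{F}^*_{i+\frac12}-\frac12\mathbf{D}^o_{i+\frac12}[[\mathbf{v}]]_{i+\frac12},$$ where the numerical diffusion term is $$\frac12\mathbf{D}^o_{i+\frac12}[[\mathbf{v}]]_{i+\frac12}=\begin{cases}\mathbf{F}^*_{i+\frac12}-\mathbf{F}^s_{i+\frac12} & \text{if } \operatorname{sign}\big(\mathbf{F}^*_{i+\frac12}-\mathbf{F}^s_{i+\frac12}\big)=\operatorname{sign}\big([[\mathbf{v}]]_{i+\frac12}\big),\\ \mathbf{0} & \text{otherwise.}\end{cases}$$ Then the semi-discrete scheme $$\frac{d}{dt}\mathbf{u}_i(t)=-\frac{1}{\Delta x_i}\left(\hat{\mathbf{F}}_{i+\frac12}-\hat{\mathbf{F}}_{i-\frac12}\right)$$ is entropy stable, and its solution satisfies, for every $i$, $$\frac{d}{dt}\eta(\mathbf{u}_i(t))+\frac{1}{\Delta x_i}\left[\hat q_{i+\frac12}-\hat q_{i-\frac12}\right]\le 0,\qquad \hat q_{i+\frac12}=q^*_{i+\frac12}-\frac12\bar{\mathbf{v}}^{T}_{i+\frac12}\mathbf{D}^o_{i+\frac12}[[\mathbf{v}]]_{i+\frac12}.$$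
   Context: The system is the one-dimensional system of conservation laws $\mathbf{u}_t+\mathbf{f}(\mathbf{u})_x=0$ with $\mathbf{f}:\mathbb{R}^m\to\mathbb{R}^m$ smooth. It is equipped with an entropy pair $(\eta,q)$: $\eta:\mathbb{R}^m\to\mathbb{R}$ is convex, the entropy variable is $\mathbf{v}=\eta_{\mathbf{u}}(\mathbf{u})$ (the map between $\mathbf{u}$ and $\mathbf{v}$ is one-to-one), and $q:\mathbb{R}^m\to\mathbb{R}$ satisfies $\mathbf{v}^T\mathbf{f}_{\mathbf{u}}=q_{\mathbf{u}}^T$. The space is divided into cells $I_i=[x_{i-\frac12},x_{i+\frac12}]$, $i\in\mathbb{Z}$, with mesh sizes $\Delta x_i>0$. $\mathbf{u}_i(t)\in\mathbb{R}^m$ is the discrete solution and $\mathbf{v}_i=\eta_{\mathbf{u}}(\mathbf{u}_i)$. Notation: $[[\mathbf{v}]]_{i+\frac12}=\mathbf{v}_{i+1}-\mathbf{v}_i$ and $\bar{\mathbf{v}}_{i+\frac12}=\frac12(\mathbf{v}_{i+1}+\mathbf{v}_i)$. A numerical flux $\mathbf{F}_{i+\frac12}=\mathbf{F}(\mathbf{u}_{i-l+1},\dots,\mathbf{u}_{i+l})\in\mathbb{R}^m$ (for a fixed $l\ge1$) is consistent if $\mathbf{F}(\mathbf{u},\dots,\mathbf{u})=\mathbf{f}(\mathbf{u})$. A numerical entropy flux $q_{i+\frac12}=q(\mathbf{u}_{i-l+1},\dots,\mathbf{u}_{i+l})\in\mathbb{R}$ is consistent if it equals $q(\mathbf{u})$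 when all arguments equal $\mathbf{u}$. A flux $\mathbf{F}^*$ is entropy conservative with associated consistent numerical entropy flux $q^*$ if solutions of $\frac{d}{dt}\mathbf{u}_i=-\frac{1}{\Delta x_i}(\mathbf{F}^*_{i+\frac12}-\mathbf{F}^*_{i-\frac12})$ satisfy $\frac{d}{dt}\eta(\mathbf{u}_i)+\frac{1}{\Delta x_i}(q^*_{i+\frac12}-q^*_{i-\frac12})=0$; that is, $\mathbf{v}_i^T(\mathbf{F}^*_{i+\frac12}-\mathbf{F}^*_{i-\frac12})=q^*_{i+\frac12}-q^*_{i-\frac12}$ for every grid function $(\mathbf{u}_j)$ and every $i$. A scheme is entropy stable if its solutions satisfy $\frac{d}{dt}\eta(\mathbf{u}_i)+\frac{1}{\Delta x_i}(\hat q_{i+\frac12}-\hat q_{i-\frac12})\le0$ for some consistent numerical entropy flux $\hat q$. "Non-oscillatory" is a descriptive term for the flux of a monotone, TVD, ENO or WENO type scheme; $\mathbf{F}^s$ may be any consistent flux. For vectors $\mathbf{a},\mathbf{b}\in\mathbb{R}^m$, $\operatorname{sign}(\mathbf{a})=\operatorname{sign}(\mathbf{b})$ means $\operatorname{sign}(a_k)=\operatorname{sign}(b_k)$ for all $k=1,\dots,m$ (with $\operatorname{sign}(0)=0$). The product $\mathbf{D}^o_{i+\frac12}[[\mathbf{v}]]_{i+\frac12}$ enters only as the vector given by the displayed case formula. *)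

theory Defs
  imports "HOL-Analysis.Analysis"
begin

fun C_k :: "nat \<Rightarrow> ('a::euclidean_space \<Rightarrow> 'b::real_normed_vector) \<Rightarrow> bool" where
  "C_k 0 f \<longleftrightarrow> continuous_on UNIV f"
| "C_k (Suc k) f \<longleftrightarrow>
     (\<forall>x. f differentiable (at x)) \<and> (\<forall>h. C_k k (\<lambda>x. frechet_derivative f (at x) h))"

definition smooth :: "('a::euclidean_space \<Rightarrow> 'b::real_normed_vector) \<Rightarrow> bool" where
  "smooth f \<longleftrightarrow> (\<forall>k. C_k k f)"

text \<open>The gradient map of \<open>\<eta>\<close>; meaningful where \<open>\<eta>\<close> is differentiable.\<close>

definition entropy_var :: "('a::euclidean_space \<Rightarrow> real) \<Rightarrow> 'a \<Rightarrow> 'a" where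
  "entropy_var \<eta> u = (THE D. GDERIV \<eta> u :> D)"

definition entropy_pair ::
  "(real ^ 'm \<Rightarrow> real ^ 'm) \<Rightarrow> (real ^ 'm \<Rightarrow> real) \<Rightarrow> (real ^ 'm \<Rightarrow> real) \<Rightarrow> bool" where
  "entropy_pair f \<eta> q \<longleftrightarrow>
     convex_on UNIV \<eta> \<and>
     (\<forall>u. \<eta> differentiable (at u)) \<and>
     inj (entropy_var \<eta>) \<and>
     (\<forall>u. GDERIV q u :> (entropy_var \<eta> u v* jacobian f (at u)))"

text \<open>
  A numerical (entropy) flux is a function of the list of its \<open>2 * l\<close> arguments. A quantity
  living at the interface between cells \<open>i\<close> and \<open>i + 1\<close> (index \<open>i + 1/2\<close> in the usual
  notation) is indexed here by \<open>i\<close>; so index \<open>i - 1\<close> stands for \<open>i - 1/2\<close>.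
\<close>

definition at_interface :: "nat \<Rightarrow> ('a list \<Rightarrow> 'b) \<Rightarrow> (int \<Rightarrow> 'a) \<Rightarrow> int \<Rightarrow> 'b" where
  "at_interface l F u i = F (map u [i - int l + 1 .. i + int l])"

definition consistent :: "nat \<Rightarrow> ('a list \<Rightarrow> 'b) \<Rightarrow> ('a \<Rightarrow> 'b) \<Rightarrow> bool" where
  "consistent l F f \<longleftrightarrow> (\<forall>u. F (replicate (2 * l) u) = f u)"

definition entropy_conservative ::
  "nat \<Rightarrow> (real ^ 'm \<Rightarrow> real) \<Rightarrow> (real ^ 'm \<Rightarrow> real) \<Rightarrow>
   ((real ^ 'm) list \<Rightarrow> real ^ 'm) \<Rightarrow> ((real ^ 'm) list \<Rightarrow> real) \<Rightarrow> bool" where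
  "entropy_conservative l \<eta> q F Q \<longleftrightarrow>
     consistent l Q q \<and>
     (\<forall>u i. entropy_var \<eta> (u i) \<bullet> (at_interface l F u i - at_interface l F u (i - 1))
            = at_interface l Q u i - at_interface l Q u (i - 1))"

text \<open>
  The next two definitions are for fluxes given directly as functions of the whole grid function
  and the interface index. Time runs through a nondegenerate interval \<open>T\<close> of any kind, with
  one-sided derivatives at end points belonging to \<open>T\<close>.
\<close>

definition semidiscrete_solution ::
  "(int \<Rightarrow> real) \<Rightarrow> ((int \<Rightarrow> real ^ 'm) \<Rightarrow> int \<Rightarrow> real ^ 'm) \<Rightarrow>
   real set \<Rightarrow> (real \<Rightarrow> int \<Rightarrow> real ^ 'm) \<Rightarrow> bool" where
  "semidiscrete_solution \<Delta>x G T u \<longleftrightarrow>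
     is_interval T \<and> interior T \<noteq> {} \<and>
     (\<forall>t\<in>T. \<forall>i. ((\<lambda>s. u s i) has_vector_derivative
                   - ((1 / \<Delta>x i) *\<^sub>R (G (u t) i - G (u t) (i - 1)))) (at t within T))"

definition satisfies_entropy_inequality ::
  "(int \<Rightarrow> real) \<Rightarrow> (real ^ 'm \<Rightarrow> real) \<Rightarrow> ((int \<Rightarrow> real ^ 'm) \<Rightarrow> int \<Rightarrow> real ^ 'm) \<Rightarrow>
   ((int \<Rightarrow> real ^ 'm) \<Rightarrow> int \<Rightarrow> real) \<Rightarrow> bool" where
  "satisfies_entropy_inequality \<Delta>x \<eta> G Q \<longleftrightarrow>
     (\<forall>T u. semidiscrete_solution \<Delta>x G T u \<longrightarrow>
        (\<forall>t\<in>T. \<forall>i. \<exists>D. ((\<lambda>s. \<eta> (u s i)) has_real_derivative D) (at t within T) \<and>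
                       D + (1 / \<Delta>x i) * (Q (u t) i - Q (u t) (i - 1)) \<le> 0))"

definition entropy_stable ::
  "nat \<Rightarrow> (int \<Rightarrow> real) \<Rightarrow> (real ^ 'm \<Rightarrow> real) \<Rightarrow> (real ^ 'm \<Rightarrow> real) \<Rightarrow>
   ((int \<Rightarrow> real ^ 'm) \<Rightarrow> int \<Rightarrow> real ^ 'm) \<Rightarrow> bool" where
  "entropy_stable l \<Delta>x \<eta> q G \<longleftrightarrow>
     (\<exists>Q. consistent l Q q \<and> satisfies_entropy_inequality \<Delta>x \<eta> G (at_interface l Q))"

definition jump :: "(int \<Rightarrow> 'a::real_vector) \<Rightarrow> int \<Rightarrow> 'a" where
  "jump v i = v (i + 1) - v i"

definition average :: "(int \<Rightarrow> 'a::real_vector) \<Rightarrow> int \<Rightarrow> 'a" where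
  "average v i = (1/2) *\<^sub>R (v (i + 1) + v i)"

text \<open>Componentwise; the library's \<^const>\<open>sgn\<close> on vectors is normalization.\<close>

definition same_sign :: "real ^ 'm \<Rightarrow> real ^ 'm \<Rightarrow> bool" where
  "same_sign a b \<longleftrightarrow> (\<forall>k. sgn (a $ k) = sgn (b $ k))"

text \<open>The vector \<open>1/2 D\<^sup>o [[v]]\<close>, as a whole, at the interface \<open>i\<close>.\<close>

definition diffusion ::
  "nat \<Rightarrow> (real ^ 'm \<Rightarrow> real) \<Rightarrow> ((real ^ 'm) list \<Rightarrow> real ^ 'm) \<Rightarrow> ((real ^ 'm) list \<Rightarrow> real ^ 'm) \<Rightarrow>
   (int \<Rightarrow> real ^ 'm) \<Rightarrow> int \<Rightarrow> real ^ 'm" where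
  "diffusion l \<eta> F_star F_s u i =
     (if same_sign (at_interface l F_star u i - at_interface l F_s u i)
                   (jump (entropy_var \<eta> \<circ> u) i)
      then at_interface l F_star u i - at_interface l F_s u i
      else 0)"

definition F_hat ::
  "nat \<Rightarrow> (real ^ 'm \<Rightarrow> real) \<Rightarrow> ((real ^ 'm) list \<Rightarrow> real ^ 'm) \<Rightarrow> ((real ^ 'm) list \<Rightarrow> real ^ 'm) \<Rightarrow>
   (int \<Rightarrow> real ^ 'm) \<Rightarrow> int \<Rightarrow> real ^ 'm" where
  "F_hat l \<eta> F_star F_s u i = at_interface l F_star u i - diffusion l \<eta> F_star F_s u i"

definition q_hat ::
  "nat \<Rightarrow> (real ^ 'm \<Rightarrow> real) \<Rightarrow> ((real ^ 'm) list \<Rightarrow> real) \<Rightarrow>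
   ((real ^ 'm) list \<Rightarrow> real ^ 'm) \<Rightarrow> ((real ^ 'm) list \<Rightarrow> real ^ 'm) \<Rightarrow>
   (int \<Rightarrow> real ^ 'm) \<Rightarrow> int \<Rightarrow> real" where
  "q_hat l \<eta> q_star F_star F_s u i =
     at_interface l q_star u i - average (entropy_var \<eta> \<circ> u) i \<bullet> diffusion l \<eta> F_star F_s u i"

end

theory Submission
  imports Defs
begin

text \<open>
  Entropy conservation of \<open>F\<^sup>*\<close> cancels all contributions except those of the diffusion vectors
  \<open>d\<close>. Since \<open>v i\<close> differs from the averages at its two interfaces by half a jump, the entropy
  residual is \<open>- (1/2) (jump v i \<bullet> d i + jump v (i - 1) \<bullet> d (i - 1)) / \<Delta>x i\<close>, and the sign condition
  makes both inner products nonnegative.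
\<close>

text \<open>Makes the \<open>THE\<close> in \<open>entropy_var\<close> meaningful. By Riesz
  representation the derivative \<open>L\<close> is the inner product with
  \<open>adjoint L 1\<close>, and uniqueness of derivatives excludes any other gradient.\<close>

lemma gderiv_entropy_var:
  fixes \<eta> :: "'a::euclidean_space \<Rightarrow> real"
  assumes "\<eta> differentiable (at u)"
  shows "GDERIV \<eta> u :> entropy_var \<eta> u"
proof -
  obtain L where L: "(\<eta> has_derivative L) (at u)"
    using assms unfolding differentiable_def by blast
  then have "linear L"
    by (rule has_derivative_linear)
  then have "L = (\<lambda>h. h \<bullet> adjoint L 1)"
    by (simp add: fun_eq_iff adjoint_works)
  then have D: "GDERIV \<eta> u :> adjoint L 1"
    using L unfolding gderiv_def by simp
  have "E = adjoint L 1" if "GDERIV \<eta> u :> E" for E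
  proof -
    have "(\<lambda>h. h \<bullet> E) = (\<lambda>h. h \<bullet> adjoint L 1)"
      using that D unfolding gderiv_def by (rule has_derivative_unique)
    then show ?thesis
      by (simp add: fun_eq_iff vector_eq_ldot)
  qed
  with D show ?thesis
    unfolding entropy_var_def by (rule theI)
qed

text \<open>The time derivative stays relative to \<open>T\<close>, as in
  \<open>semidiscrete_solution\<close>, so end points of the time interval are covered.\<close>

lemma gderiv_chain_within:
  fixes \<eta> :: "'a::real_inner \<Rightarrow> real"
  assumes "GDERIV \<eta> (u t) :> D" and "(u has_vector_derivative u') (at t within T)"
  shows "((\<lambda>s. \<eta> (u s)) has_real_derivative D \<bullet> u') (at t within T)"
proof -
  have "((\<eta> \<circ> u) has_derivative (\<lambda>h. h \<bullet> D) \<circ> (\<lambda>x. x *\<^sub>R u')) (at t within T)"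
    using assms unfolding gderiv_def has_vector_derivative_def
    by (intro diff_chain_within) (auto intro: has_derivative_at_withinI)
  then show ?thesis
    by (simp add: has_field_derivative_def o_def inner_commute[of u' D] mult_commute_abs)
qed

lemma same_sign_inner_nonneg:
  assumes "same_sign a b"
  shows "0 \<le> a \<bullet> b"
proof -
  have "0 \<le> a $ k * b $ k" for k
  proof -
    have "sgn (a $ k) = sgn (b $ k)"
      using assms by (simp add: same_sign_def)
    then show ?thesis
      by (auto simp: sgn_if zero_le_mult_iff split: if_splits)
  qed
  then show ?thesis
    by (simp add: inner_vec_def sum_nonneg)
qed

text \<open>Serves constant states: the jump of the entropy variable vanishes there, and then both
  branches of \<open>diffusion\<close> give 0.\<close>

lemma same_sign_0_iff: "same_sign a 0 \<longleftrightarrow> a = 0"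
  by (simp add: same_sign_def vec_eq_iff sgn_eq_0_iff)

lemma jump_inner_diffusion_nonneg:
  "0 \<le> jump (entropy_var \<eta> \<circ> u) i \<bullet> diffusion l \<eta> F_star F_s u i"
  unfolding diffusion_def by (subst inner_commute) (simp add: same_sign_inner_nonneg)

lemma entropy_residual_nonpos:
  fixes v d F :: "int \<Rightarrow> 'a::real_inner" and Q :: "int \<Rightarrow> real"
  assumes "v i \<bullet> (F i - F (i - 1)) = Q i - Q (i - 1)"
    and "0 \<le> jump v i \<bullet> d i" and "0 \<le> jump v (i - 1) \<bullet> d (i - 1)" and "0 < h"
  shows "v i \<bullet> - ((1 / h) *\<^sub>R ((F i - d i) - (F (i - 1) - d (i - 1))))
    + (1 / h) * ((Q i - average v i \<bullet> d i) - (Q (i - 1) - average v (i - 1) \<bullet> d (i - 1))) \<le> 0"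
    (is "?r \<le> 0")
proof -
  have "?r = (1 / h) * (Q i - Q (i - 1) - v i \<bullet> (F i - F (i - 1))
      + (v i - average v i) \<bullet> d i - (v i - average v (i - 1)) \<bullet> d (i - 1))"
    by (simp add: algebra_simps)
  also have "v i - average v i = - (1/2) *\<^sub>R jump v i"
    by (simp add: average_def jump_def algebra_simps flip: scaleR_add_left)
  \<comment> \<open>Cell \<open>i\<close> is the right neighbour of interface \<open>i - 1\<close>
    but the left one of interface \<open>i\<close>, so the half jump changes sign. The minus in
    front of this term compensates, and both interfaces dissipate.\<close>
  also have "v i - average v (i - 1) = (1/2) *\<^sub>R jump v (i - 1)"
    by (simp add: average_def jump_def algebra_simps flip: scaleR_add_left)
  also have "(1 / h) * (Q i - Q (i - 1) - v i \<bullet> (F i - F (i - 1))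
      + (- (1/2) *\<^sub>R jump v i) \<bullet> d i - ((1/2) *\<^sub>R jump v (i - 1)) \<bullet> d (i - 1))
    = - ((1 / h) * (1/2) * (jump v i \<bullet> d i + jump v (i - 1) \<bullet> d (i - 1)))"
    using assms(1) by (simp add: algebra_simps)
  also have "\<dots> \<le> 0"
    using assms(2-4) by simp
  finally show ?thesis .
qed

text \<open>The scheme gives the time derivative in each cell explicitly, so the chain rule reduces
  the claim to an inequality between grid values at one fixed time.\<close>

lemma F_hat_entropy_inequality:
  fixes \<eta> :: "real ^ 'm \<Rightarrow> real"
  assumes "\<And>u. \<eta> differentiable (at u)" and "\<And>i. 0 < \<Delta>x i"
    and "entropy_conservative l \<eta> q F_star q_star"
  shows "satisfies_entropy_inequality \<Delta>x \<eta> (F_hat l \<eta> F_star F_s) (q_hat l \<eta> q_star F_star F_s)"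
  unfolding satisfies_entropy_inequality_def
proof (intro allI impI ballI)
  fix T t i and u :: "real \<Rightarrow> int \<Rightarrow> real ^ 'm"
  let ?G = "F_hat l \<eta> F_star F_s (u t)" and ?Q = "q_hat l \<eta> q_star F_star F_s (u t)"
  let ?u' = "- ((1 / \<Delta>x i) *\<^sub>R (?G i - ?G (i - 1)))"
  let ?D = "entropy_var \<eta> (u t i) \<bullet> ?u'"
  assume "semidiscrete_solution \<Delta>x (F_hat l \<eta> F_star F_s) T u" "t \<in> T"
  then have "((\<lambda>s. u s i) has_vector_derivative ?u') (at t within T)"
    by (simp add: semidiscrete_solution_def)
  then have "((\<lambda>s. \<eta> (u s i)) has_real_derivative ?D) (at t within T)"
    by (intro gderiv_chain_within[where u = "\<lambda>s. u s i"] gderiv_entropy_var assms(1))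
  moreover have "?D + (1 / \<Delta>x i) * (?Q i - ?Q (i - 1)) \<le> 0"
  proof -
    let ?v = "entropy_var \<eta> \<circ> u t" and ?d = "diffusion l \<eta> F_star F_s (u t)"
    \<comment> \<open>Inside this block \<open>?Q\<close> is rebound to the values of
      \<open>q_star\<close>; \<open>?thesis\<close> still speaks of \<open>q_hat\<close>.\<close>
    let ?F = "at_interface l F_star (u t)" and ?Q = "at_interface l q_star (u t)"
    have "?v i \<bullet> (?F i - ?F (i - 1)) = ?Q i - ?Q (i - 1)"
      using assms(3) by (simp add: entropy_conservative_def)
    moreover have "0 \<le> jump ?v j \<bullet> ?d j" for j
      by (rule jump_inner_diffusion_nonneg)
    ultimately show ?thesis
      using entropy_residual_nonpos[of ?v i ?F ?Q ?d "\<Delta>x i"] assms(2)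
      by (simp only: F_hat_def q_hat_def o_apply)
  qed
  ultimately show "\<exists>D. ((\<lambda>s. \<eta> (u s i)) has_real_derivative D) (at t within T) \<and>
      D + (1 / \<Delta>x i) * (?Q i - ?Q (i - 1)) \<le> 0"
    by blast
qed

text \<open>
  Evaluating a grid functional at interface \<open>0\<close> of \<open>stencil_grid l xs\<close> turns it into a function of
  the stencil values \<open>xs\<close>. The grid function is junk outside the cells \<open>- l + 1, \<dots>, l\<close>.
\<close>

definition stencil_grid :: "nat \<Rightarrow> 'a list \<Rightarrow> int \<Rightarrow> 'a" where
  "stencil_grid l xs j = xs ! nat (j + int l - 1)"

lemma at_interface_stencil_grid:
  assumes "length xs = 2 * l"
  shows "at_interface l F (stencil_grid l xs) 0 = F xs"
proof -
  have "map (stencil_grid l xs) [0 - int l + 1 .. 0 + int l] = xs"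
    using assms by (intro nth_equalityI) (auto simp: stencil_grid_def)
  then show ?thesis
    by (simp add: at_interface_def)
qed

lemma at_interface_stencil_grid_map:
  "at_interface l F (stencil_grid l (map u [i - int l + 1 .. i + int l])) 0 = at_interface l F u i"
  by (subst at_interface_stencil_grid) (simp_all add: at_interface_def)

lemma stencil_grid_map:
  assumes "- int l < j" and "j \<le> int l"
  shows "stencil_grid l (map u [i - int l + 1 .. i + int l]) j = u (i + j)"
  using assms by (simp add: stencil_grid_def algebra_simps)

lemma stencil_grid_replicate:
  assumes "- int l < j" and "j \<le> int l"
  shows "stencil_grid l (replicate (2 * l) a) j = a"
  using assms by (simp add: stencil_grid_def nat_less_iff)

text \<open>Entropy stability asks for a flux depending on the list of stencil values, whereas
  \<open>q_hat\<close> takes a whole grid function. Placing the stencil around interface 0 bridges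
  the two.\<close>

definition q_hat_flux ::
  "nat \<Rightarrow> (real ^ 'm \<Rightarrow> real) \<Rightarrow> ((real ^ 'm) list \<Rightarrow> real) \<Rightarrow>
   ((real ^ 'm) list \<Rightarrow> real ^ 'm) \<Rightarrow> ((real ^ 'm) list \<Rightarrow> real ^ 'm) \<Rightarrow> (real ^ 'm) list \<Rightarrow> real" where
  "q_hat_flux l \<eta> q_star F_star F_s xs = q_hat l \<eta> q_star F_star F_s (stencil_grid l xs) 0"

text \<open>\<open>q_hat\<close> at interface 0 reads \<open>F_star\<close>, \<open>F_s\<close> and
  \<open>q_star\<close> on the stencil and the states in cells 0 and 1. As \<open>l \<ge> 1\<close>,
  these cells belong to the stencil, so no junk value enters.\<close>

lemma at_interface_q_hat_flux:
  assumes "l \<ge> 1"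
  shows "at_interface l (q_hat_flux l \<eta> q_star F_star F_s) u i = q_hat l \<eta> q_star F_star F_s u i"
proof -
  let ?g = "stencil_grid l (map u [i - int l + 1 .. i + int l])"
  have "?g 0 = u i" "?g 1 = u (i + 1)"
    using assms stencil_grid_map[of l 0 u i] stencil_grid_map[of l 1 u i] by simp_all
  then have "q_hat l \<eta> q_star F_star F_s ?g 0 = q_hat l \<eta> q_star F_star F_s u i"
    by (simp add: q_hat_def diffusion_def average_def jump_def
        at_interface_stencil_grid_map)
  then show ?thesis
    by (simp add: at_interface_def q_hat_flux_def)
qed

lemma consistent_q_hat_flux:
  fixes \<eta> :: "real ^ 'm \<Rightarrow> real"
  assumes "l \<ge> 1" and "consistent l q_star q"
  shows "consistent l (q_hat_flux l \<eta> q_star F_star F_s) q"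
  unfolding consistent_def
proof
  fix a :: "real ^ 'm"
  let ?g = "stencil_grid l (replicate (2 * l) a)"
  have "?g 0 = a" "?g 1 = a"
    using assms(1) by (simp_all add: stencil_grid_replicate)
  then have "jump (entropy_var \<eta> \<circ> ?g) 0 = 0"
    by (simp add: jump_def)
  then have "diffusion l \<eta> F_star F_s ?g 0 = 0"
    by (simp add: diffusion_def same_sign_0_iff)
  then show "q_hat_flux l \<eta> q_star F_star F_s (replicate (2 * l) a) = q a"
    using assms(2) by (simp add: q_hat_flux_def q_hat_def at_interface_stencil_grid consistent_def)
qed

theorem theorem4:
  fixes f :: "real ^ 'm \<Rightarrow> real ^ 'm"
    and \<eta> q :: "real ^ 'm \<Rightarrow> real"
    and \<Delta>x :: "int \<Rightarrow> real"
    and l :: nat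
    and F_star F_s :: "(real ^ 'm) list \<Rightarrow> real ^ 'm"
    and q_star :: "(real ^ 'm) list \<Rightarrow> real"
  assumes "smooth f"
    and "entropy_pair f \<eta> q"
    and "\<And>i. \<Delta>x i > 0"
    and "l \<ge> 1"
    and "consistent l F_star f"
    and "entropy_conservative l \<eta> q F_star q_star"
    and "consistent l F_s f"
  shows "entropy_stable l \<Delta>x \<eta> q (F_hat l \<eta> F_star F_s) \<and>
         satisfies_entropy_inequality \<Delta>x \<eta> (F_hat l \<eta> F_star F_s) (q_hat l \<eta> q_star F_star F_s)"
proof -
  have ineq:
    "satisfies_entropy_inequality \<Delta>x \<eta> (F_hat l \<eta> F_star F_s) (q_hat l \<eta> q_star F_star F_s)"
    using assms(2,3,6) by (intro F_hat_entropy_inequality) (auto simp: entropy_pair_def)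
  \<comment> \<open>Equality as functions lets \<open>q_hat_flux\<close> be the witness for
    stability, with the inequality already shown for \<open>q_hat\<close>.\<close>
  moreover have "at_interface l (q_hat_flux l \<eta> q_star F_star F_s) = q_hat l \<eta> q_star F_star F_s"
    using assms(4) by (simp add: fun_eq_iff at_interface_q_hat_flux)
  moreover have "consistent l (q_hat_flux l \<eta> q_star F_star F_s) q"
    using assms(4,6) by (simp add: consistent_q_hat_flux entropy_conservative_def)
  ultimately show ?thesis
    unfolding entropy_stable_def by metis
qed

end
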